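(* For any deterministic oblivious algorithm $\mathcal{A}$ finding spanning forests, and any numbers $n$ and $m$ with $m=\mathcal{O}(n^2)$, there exists a connected simple graph $G_\mathcal{A}$ with $n$ vertices and $\Theta(m)$ edges such that $\mathcal{A}$ requires time $\Omega(m)$ to find a spanning tree of $G_\mathcal{A}$. (The constants implicit in $\mathcal{O},\Theta,\Omega$ do not depend on $\mathcal{A}$, $n$, $m$.)
   Context: Model: the input is a simple graph $G$ (no weights) on vertex set $\{1,\dots,n\}$; each of its edges is held by exactly one station, each station holds one edge, stations have distinct IDs, and $n$ is known to all stations. Computation is synchronous. In each step every station broadcasts or not; if exactly one station broadcasts its message (its edge) is heard by all; if none, silence is heard; if two or more, a collision signal is heard. An edge is revealed when it is heard; the algorithm finds a spanning forest (here a spanning tree, as the graph is connected) if all edges of some maximal acyclic subgraph of $G$ are revealed. A deterministic oblivious algorithm is a fixed sequence of queries $Q_1,Q_2,\dots$, determined in advance depending only on $n$, where each query is a set of station IDs and/or possible edges on $\{1,\dots,n\}$; at step $i$ exactly the stations whose ID or whose edge belongs to $Q_i$ broadcast their edges. Time is the number of steps needed until the edges of a spanning tree have been revealed.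
   Formalization: The formal statement also assumes n ≥ 2 and m ≥ c·n for an arbitrary fixed c > 0 (constants may depend on c), because a connected graph on n vertices has at least n−1 edges, so Θ(m) edges is impossible for m much smaller than n. *)

theory Defs
  imports Complex_Main
begin

type_synonym edge = "nat set"

definition possible_edges :: "nat \<Rightarrow> edge set" where
  "possible_edges n = {e. e \<subseteq> {1..n} \<and> card e = 2}"

text \<open>A simple graph on the vertex set \<open>{1..n}\<close> is given by its edge set.\<close>

definition simple_graph :: "nat \<Rightarrow> edge set \<Rightarrow> bool" where
  "simple_graph n E \<longleftrightarrow> E \<subseteq> possible_edges n"

definition connected_graph :: "nat \<Rightarrow> edge set \<Rightarrow> bool" where
  "connected_graph n E \<longleftrightarrow> (\<forall>u\<in>{1..n}. \<forall>v\<in>{1..n}. (u, v) \<in> {(x, y). {x, y} \<in> E}\<^sup>*)"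

definition graph_cycle :: "edge set \<Rightarrow> nat list \<Rightarrow> bool" where
  "graph_cycle E p \<longleftrightarrow> length p \<ge> 3 \<and> distinct p \<and>
     (\<forall>i<length p. {p ! i, p ! (Suc i mod length p)} \<in> E)"

definition acyclic_graph :: "edge set \<Rightarrow> bool" where
  "acyclic_graph E \<longleftrightarrow> (\<nexists>p. graph_cycle E p)"

definition spanning_forest :: "edge set \<Rightarrow> edge set \<Rightarrow> bool" where
  "spanning_forest E F \<longleftrightarrow> F \<subseteq> E \<and> acyclic_graph F \<and>
     (\<forall>F'. F \<subseteq> F' \<and> F' \<subseteq> E \<and> acyclic_graph F' \<longrightarrow> F' = F)"

text \<open>
  Each edge is held by exactly one station and each station holds one edge, so a station is
  identified with its edge; \<open>sid e\<close> is the ID of the station holding \<open>e\<close>.  The set \<open>ids n\<close>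
  consists of the IDs that stations may have in networks with \<open>n\<close>-vertex input graphs.
  It may be infinite, e.g. all natural numbers.
\<close>

definition id_assignment :: "nat set \<Rightarrow> edge set \<Rightarrow> (edge \<Rightarrow> nat) \<Rightarrow> bool" where
  "id_assignment I E sid \<longleftrightarrow> inj_on sid E \<and> sid ` E \<subseteq> I"

text \<open>Every simple graph with \<open>n\<close> vertices has an ID assignment.\<close>

definition enough_ids :: "(nat \<Rightarrow> nat set) \<Rightarrow> bool" where
  "enough_ids ids \<longleftrightarrow> (\<forall>n. infinite (ids n) \<or> n choose 2 \<le> card (ids n))"

datatype query_item = Station nat | Edge edge

type_synonym query = "query_item set"

text \<open>
  An oblivious algorithm \<open>A\<close> uses the query \<open>A n i\<close> at step \<open>i\<close> for an input graph with \<open>n\<close>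
  vertices.  Steps are numbered from \<open>1\<close>; the entry \<open>A n 0\<close> is never used.
\<close>

type_synonym algorithm = "nat \<Rightarrow> nat \<Rightarrow> query"

definition oblivious_algorithm :: "(nat \<Rightarrow> nat set) \<Rightarrow> algorithm \<Rightarrow> bool" where
  "oblivious_algorithm ids A \<longleftrightarrow>
     (\<forall>n. \<forall>i\<ge>1. A n i \<subseteq> Station ` ids n \<union> Edge ` possible_edges n)"

definition broadcasting :: "edge set \<Rightarrow> (edge \<Rightarrow> nat) \<Rightarrow> query \<Rightarrow> edge set" where
  "broadcasting E sid Q = {e \<in> E. Station (sid e) \<in> Q \<or> Edge e \<in> Q}"

definition revealed :: "algorithm \<Rightarrow> nat \<Rightarrow> edge set \<Rightarrow> (edge \<Rightarrow> nat) \<Rightarrow> nat \<Rightarrow> edge set" where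
  "revealed A n E sid t = {e. \<exists>i\<in>{1..t}. broadcasting E sid (A n i) = {e}}"

definition forest_found :: "algorithm \<Rightarrow> nat \<Rightarrow> edge set \<Rightarrow> (edge \<Rightarrow> nat) \<Rightarrow> nat \<Rightarrow> bool" where
  "forest_found A n E sid t \<longleftrightarrow> (\<exists>F. spanning_forest E F \<and> F \<subseteq> revealed A n E sid t)"

definition finds_spanning_forests :: "(nat \<Rightarrow> nat set) \<Rightarrow> algorithm \<Rightarrow> bool" where
  "finds_spanning_forests ids A \<longleftrightarrow>
     (\<forall>n E sid. simple_graph n E \<and> id_assignment (ids n) E sid \<longrightarrow> (\<exists>t. forest_found A n E sid t))"

text \<open>Meaningful only if some \<open>t\<close> qualifies, which \<open>finds_spanning_forests\<close> guarantees.\<close>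

definition running_time :: "algorithm \<Rightarrow> nat \<Rightarrow> edge set \<Rightarrow> (edge \<Rightarrow> nat) \<Rightarrow> nat" where
  "running_time A n E sid = (LEAST t. forest_found A n E sid t)"

end

theory Submission imports Defs begin

text \<open>
  Fix an arbitrary injective assignment of IDs to all possible edges; the queries then become
  edge sets \<open>T\<^sub>1, T\<^sub>2, \<dots>\<close>.  Let \<open>V = {1..k}\<close> with \<open>k\<^sup>2\<close> of order \<open>m\<close>, choose a uniformly random
  \<open>S \<subseteq> V\<close>, and let the graph consist of the cliques on \<open>S\<close> and \<open>V - S\<close>, one edge \<open>f\<close> between
  them, and pendant edges for the remaining vertices.  The bridge \<open>f\<close> lies in every spanning tree,
  and \<open>T\<^sub>i\<close> can reveal it only if all edges of \<open>T\<^sub>i\<close> within \<open>V\<close> are cut by \<open>S\<close>.  The \<open>\<plusminus>1\<close> indicators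
  of single edges being cut are orthogonal, so by Chebyshev's inequality all edges of \<open>T\<^sub>i\<close> are
  cut with probability at most \<open>1 / |T\<^sub>i|\<close>.  Hence each query excludes, on average, at most one
  choice of \<open>f\<close>, whereas the average number of choices is half the number of pairs in \<open>V\<close>.
\<close>

section \<open>Random cuts\<close>

text \<open>For a pair \<open>e\<close>, meeting \<open>S\<close> in exactly one point means being
  cut by \<open>S\<close>. Signs are used instead of a 0/1 indicator because they are centred and
  orthogonal over all \<open>S\<close>.\<close>

definition cut_sign :: "'a set \<Rightarrow> 'a set \<Rightarrow> int" where
  "cut_sign S e = (if card (e \<inter> S) = 1 then -1 else 1)"

text \<open>Moving one endpoint across the cut toggles the state of the pair:
  \<open>e \<inter> S\<close> misses \<open>w\<close>, so its size goes from 0 to 1 or from 1 to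
  2.\<close>

lemma cut_sign_insert_in:
  assumes "card e = 2" "w \<in> e" "w \<notin> S"
  shows "cut_sign (insert w S) e = - cut_sign S e"
proof -
  have fin: "finite e" using assms(1) card.infinite by fastforce
  have "e \<inter> S \<subseteq> e - {w}" using assms by auto
  then have "card (e \<inter> S) \<le> 1"
    using card_mono[of "e - {w}" "e \<inter> S"] fin assms by simp
  moreover have "card (e \<inter> insert w S) = Suc (card (e \<inter> S))"
    using assms fin by simp
  ultimately show ?thesis by (auto simp: cut_sign_def)
qed

lemma cut_sign_insert_notin:
  "w \<notin> e \<Longrightarrow> cut_sign (insert w S) e = cut_sign S e"
  by (simp add: cut_sign_def)

text \<open>Toggling the membership of \<open>w\<close> is a sign-reversing involution on the
  subsets of \<open>V\<close>, so the sum equals its own negative.\<close>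

lemma sum_Pow_alternating:
  fixes g :: "'a set \<Rightarrow> int"
  assumes "finite V" "w \<in> V" "\<And>S. w \<notin> S \<Longrightarrow> g (insert w S) = - g S"
  shows "sum g (Pow V) = 0"
proof -
  let ?h = "\<lambda>S. if w \<in> S then S - {w} else insert w S"
  have "sum g (Pow V) = (\<Sum>S\<in>Pow V. - g S)"
  proof (rule sum.reindex_bij_witness[where i = ?h and j = ?h])
    fix S assume "S \<in> Pow V"
    show "- g (?h S) = g S"
      using assms(3)[of S] assms(3)[of "S - {w}"] by (auto simp: insert_absorb)
  qed (use assms(2) in \<open>auto simp: insert_absorb\<close>)
  then show ?thesis by (simp add: sum_negf)
qed

lemma sum_cut_sign:
  assumes "finite V" "e \<subseteq> V" "card e = 2"
  shows "(\<Sum>S\<in>Pow V. cut_sign S e) = 0"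
proof -
  obtain w where "w \<in> e" using assms(3) by (metis card.empty ex_in_conv zero_neq_numeral)
  then show ?thesis using assms cut_sign_insert_in by (intro sum_Pow_alternating) auto
qed

lemma sum_cut_sign_mult:
  assumes "finite V" "e \<subseteq> V" "card e = 2" "e' \<subseteq> V" "card e' = 2"
  shows "(\<Sum>S\<in>Pow V. cut_sign S e * cut_sign S e') = (if e = e' then 2 ^ card V else 0)"
proof (cases "e = e'")
  case True
  have "cut_sign S e' * cut_sign S e' = 1" for S by (simp add: cut_sign_def)
  then show ?thesis using True by (simp add: card_Pow assms)
next
  case False
  have fin: "finite e" "finite e'" using assms finite_subset by blast+
  \<comment> \<open>Distinct pairs have the same size, so some \<open>w\<close> lies in exactly one
    of them; toggling it flips exactly one factor of the product.\<close>
  have "\<not> e \<subseteq> e'" using False card_subset_eq[of e' e] fin assms by auto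
  then obtain w where w: "w \<in> e" "w \<notin> e'" by blast
  have "(\<Sum>S\<in>Pow V. cut_sign S e * cut_sign S e') = 0"
    using w assms by (intro sum_Pow_alternating[of V w])
      (auto simp: cut_sign_insert_in cut_sign_insert_notin)
  then show ?thesis using False by simp
qed

text \<open>The sign is 1 minus twice the indicator of being cut. Since the signs sum to zero,
  exactly half of all subsets cut \<open>e\<close>.\<close>

lemma card_cuts_of_edge:
  assumes "finite V" "e \<subseteq> V" "card e = 2"
  shows "2 * int (card {S \<in> Pow V. card (e \<inter> S) = 1}) = 2 ^ card V"
proof -
  have "cut_sign S e = 1 - 2 * of_bool (card (e \<inter> S) = 1)" for S
    by (simp add: cut_sign_def)
  then have "(\<Sum>S\<in>Pow V. cut_sign S e)
      = int (card (Pow V)) - 2 * (\<Sum>S\<in>Pow V. of_bool (card (e \<inter> S) = 1))"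
    by (simp add: sum_subtractf sum_distrib_left)
  also have "(\<Sum>S\<in>Pow V. of_bool (card (e \<inter> S) = 1) :: int)
      = int (card {S \<in> Pow V. card (e \<inter> S) = 1})"
    using assms(1) by (simp add: of_bool_def sum.If_cases Int_def)
  finally show ?thesis using assms by (simp add: sum_cut_sign card_Pow)
qed

text \<open>A second moment bound in counting form: if \<open>S\<close> cuts every edge of
  \<open>T\<close>, the signs add up to -|T|, while orthogonality makes the squared sums over all
  \<open>S\<close> total only |T| times \<open>2 ^ card V\<close>.\<close>

lemma card_cuts_of_all:
  assumes "finite V" "T \<subseteq> {e. e \<subseteq> V \<and> card e = 2}"
  shows "card T * card {S \<in> Pow V. \<forall>e\<in>T. card (e \<inter> S) = 1} \<le> 2 ^ card V"
proof (cases "T = {}")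
  case True
  then show ?thesis by simp
next
  case False
  let ?Z = "{S \<in> Pow V. \<forall>e\<in>T. card (e \<inter> S) = 1}"
  have fin: "finite T"
    by (rule finite_subset[OF assms(2)]) (simp add: assms(1))
  have "int (card T)^2 * int (card ?Z) = (\<Sum>S\<in>?Z. (\<Sum>e\<in>T. cut_sign S e)\<^sup>2)"
    by (simp add: cut_sign_def)
  also have "\<dots> \<le> (\<Sum>S\<in>Pow V. (\<Sum>e\<in>T. cut_sign S e)\<^sup>2)"
    using assms(1) by (intro sum_mono2) auto
  also have "\<dots> = (\<Sum>S\<in>Pow V. \<Sum>e\<in>T. \<Sum>e'\<in>T. cut_sign S e * cut_sign S e')"
    by (simp add: power2_eq_square sum_product)
  also have "\<dots> = (\<Sum>e\<in>T. \<Sum>S\<in>Pow V. \<Sum>e'\<in>T. cut_sign S e * cut_sign S e')"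
    by (rule sum.swap)
  also have "\<dots> = (\<Sum>e\<in>T. \<Sum>e'\<in>T. \<Sum>S\<in>Pow V. cut_sign S e * cut_sign S e')"
    by (rule sum.cong[OF refl], rule sum.swap)
  also have "\<dots> = (\<Sum>e\<in>T. \<Sum>e'\<in>T. if e = e' then 2 ^ card V else 0)"
    using assms by (intro sum.cong refl sum_cut_sign_mult) auto
  also have "\<dots> = int (card T) * 2 ^ card V"
    using fin by simp
  finally have "int (card T) * (int (card T) * int (card ?Z)) \<le> int (card T) * 2 ^ card V"
    by (simp add: power2_eq_square mult.assoc)
  moreover have "card T > 0" using False fin by (simp add: card_gt_0_iff)
  ultimately have "int (card T) * int (card ?Z) \<le> 2 ^ card V"
    by simp
  then have "int (card T * card ?Z) \<le> int (2 ^ card V)" by simp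
  then show ?thesis by (simp only: of_nat_le_iff)
qed

text \<open>Double counting of pairs (f, S) with \<open>f\<close> cut by \<open>S\<close>. If all of
  them failed, each would be charged to a query \<open>T i\<close> that contains \<open>f\<close>
  and whose edges within \<open>V\<close> are all cut by \<open>S\<close>. One query absorbs at most
  \<open>2 ^ card V\<close> pairs, so \<open>t\<close> queries cannot absorb all of them, which
  number half of \<open>card P * 2 ^ card V\<close>.\<close>

lemma ex_cut_edge_not_isolated:
  fixes T :: "nat \<Rightarrow> 'a set set"
  assumes V: "finite V" and t: "2 * t < card V choose 2"
  shows "\<exists>S f. S \<subseteq> V \<and> f \<subseteq> V \<and> card f = 2 \<and> card (f \<inter> S) = 1 \<and>
    (\<forall>i\<in>{1..t}. f \<in> T i \<longrightarrow> (\<exists>e\<in>T i. e \<subseteq> V \<and> card e = 2 \<and> card (e \<inter> S) \<noteq> 1))"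
proof (rule ccontr)
  assume contra: "\<not> ?thesis"
  define P where "P = {e. e \<subseteq> V \<and> card e = 2}"
  define Z where "Z i = {S \<in> Pow V. \<forall>e\<in>T i \<inter> P. card (e \<inter> S) = 1}" for i
  have finP: "finite P" and finZ: "finite (Z i)" for i
    using V unfolding P_def Z_def by auto
  have cP: "card P = card V choose 2" unfolding P_def using n_subsets[OF V] by simp
  let ?X = "SIGMA e:P. {S \<in> Pow V. card (e \<inter> S) = 1}"
  have "?X \<subseteq> (\<Union>i\<in>{1..t}. (T i \<inter> P) \<times> Z i)"
  proof
    fix x assume "x \<in> ?X"
    then obtain f S where x: "x = (f, S)" and fS: "f \<in> P" "S \<subseteq> V" "card (f \<inter> S) = 1" by auto
    then have "\<not> (\<forall>i\<in>{1..t}. f \<in> T i \<longrightarrow> (\<exists>e\<in>T i. e \<subseteq> V \<and> card e = 2 \<and> card (e \<inter> S) \<noteq> 1))"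
      using contra unfolding P_def by blast
    then obtain i where "i \<in> {1..t}" "f \<in> T i" "\<forall>e\<in>T i \<inter> P. card (e \<inter> S) = 1"
      unfolding P_def by blast
    then show "x \<in> (\<Union>i\<in>{1..t}. (T i \<inter> P) \<times> Z i)"
      using x fS unfolding Z_def by blast
  qed
  then have "card ?X \<le> card (\<Union>i\<in>{1..t}. (T i \<inter> P) \<times> Z i)"
    using finP finZ by (intro card_mono) auto
  also have "\<dots> \<le> (\<Sum>i\<in>{1..t}. card ((T i \<inter> P) \<times> Z i))"
    by (rule card_UN_le) simp
  also have "\<dots> \<le> (\<Sum>i\<in>{1..t}. 2 ^ card V)"
    unfolding card_cartesian_product Z_def
    by (intro sum_mono card_cuts_of_all V) (auto simp: P_def)
  finally have "card ?X \<le> t * 2 ^ card V" by simp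
  moreover have "card P * 2 ^ card V = 2 * card ?X"
  proof -
    have "int (2 * card ?X) = (\<Sum>e\<in>P. 2 * int (card {S \<in> Pow V. card (e \<inter> S) = 1}))"
      using V finP by (subst card_SigmaI) (auto simp: sum_distrib_left)
    also have "\<dots> = (\<Sum>e\<in>P. 2 ^ card V)"
      by (intro sum.cong refl card_cuts_of_edge V) (auto simp: P_def)
    also have "\<dots> = int (card P * 2 ^ card V)" by simp
    finally show ?thesis by linarith
  qed
  ultimately have "card P * 2 ^ card V \<le> 2 * t * 2 ^ card V" by simp
  then show False using t cP by simp
qed

section \<open>Bridges and spanning forests\<close>

text \<open>Only \<open>f\<close> crosses between \<open>W\<close> and its complement, and a cycle
  that crosses once would have to cross back by another edge.\<close>

lemma bridge_not_in_cycle: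
  assumes cyc: "graph_cycle (insert f F) p" and "f = {a, b}" "a \<in> W" "b \<notin> W"
    and F: "\<And>u v. {u, v} \<in> F \<Longrightarrow> u \<in> W \<longleftrightarrow> v \<in> W"
  shows "graph_cycle F p"
proof (rule ccontr)
  assume no: "\<not> graph_cycle F p"
  let ?L = "length p"
  have L: "?L \<ge> 3" and d: "distinct p"
    and E: "\<And>i. i < ?L \<Longrightarrow> {p ! i, p ! (Suc i mod ?L)} \<in> insert f F"
    using cyc by (auto simp: graph_cycle_def)
  have pos: "0 < ?L" using L by linarith
  obtain i where i: "i < ?L" "{p ! i, p ! (Suc i mod ?L)} = f"
    using no L d E unfolding graph_cycle_def by blast
  \<comment> \<open>A second occurrence of \<open>f\<close> would traverse it backwards, making each
    of \<open>i\<close> and \<open>j\<close> the cyclic successor of the other; this is impossible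
    in length at least 3.\<close>
  have uniq: "j = i" if j: "j < ?L" "{p ! j, p ! (Suc j mod ?L)} = f" for j
  proof (rule ccontr)
    assume "j \<noteq> i"
    have "{p ! j, p ! (Suc j mod ?L)} = {p ! i, p ! (Suc i mod ?L)}" using i j by simp
    moreover have "p ! j \<noteq> p ! i" using d i j \<open>j \<noteq> i\<close> by (simp add: nth_eq_iff_index_eq)
    ultimately have "p ! j = p ! (Suc i mod ?L)" "p ! i = p ! (Suc j mod ?L)"
      by (auto simp: doubleton_eq_iff)
    moreover have "Suc i mod ?L < ?L" "Suc j mod ?L < ?L"
      using pos by simp_all
    ultimately have "j = Suc i mod ?L" "i = Suc j mod ?L"
      using d i j by (simp_all add: nth_eq_iff_index_eq)
    then show False using L i j by (auto simp: mod_Suc split: if_splits)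
  qed
  \<comment> \<open>Starting just after \<open>f\<close> and going round the cycle, every edge met
    before position \<open>i\<close> recurs lies in \<open>F\<close>, so the walk stays on one side
    of \<open>W\<close>. Taking \<open>l\<close> as the length minus 1 returns to
    \<open>p ! i\<close>, on the other side.\<close>
  have "p ! ((Suc i + l) mod ?L) \<in> W \<longleftrightarrow> p ! (Suc i mod ?L) \<in> W" if "l < ?L" for l
    using that
  proof (induction l)
    case (Suc l)
    let ?j = "(Suc i + l) mod ?L"
    have j: "?j < ?L" using pos by simp
    have "?j \<noteq> i"
      using i Suc.prems by (cases "Suc i + l < ?L") (auto simp: mod_if)
    then have "{p ! ?j, p ! (Suc ?j mod ?L)} \<in> F" using E[OF j] uniq[OF j] by blast
    then have "p ! ?j \<in> W \<longleftrightarrow> p ! (Suc ?j mod ?L) \<in> W" by (rule F)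
    moreover have "Suc ?j mod ?L = (Suc i + Suc l) mod ?L" by (simp add: mod_Suc_eq)
    ultimately show ?case using Suc by simp
  qed simp
  moreover have "?L - 1 < ?L" using pos by linarith
  ultimately have "p ! ((Suc i + (?L - 1)) mod ?L) \<in> W \<longleftrightarrow> p ! (Suc i mod ?L) \<in> W"
    by blast
  moreover have "(Suc i + (?L - 1)) mod ?L = i"
  proof -
    have "Suc i + (?L - 1) = i + ?L" using pos by linarith
    then show ?thesis using i by simp
  qed
  ultimately have "p ! i \<in> W \<longleftrightarrow> p ! (Suc i mod ?L) \<in> W" by simp
  then show False using i assms by (auto simp: doubleton_eq_iff)
qed

text \<open>Adding a missing bridge to a forest closes no cycle, which would contradict
  maximality.\<close>

lemma bridge_in_spanning_forest:
  assumes F: "spanning_forest E F" and f: "f \<in> E" "f = {a, b}" "a \<in> W" "b \<notin> W"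
    and E: "\<And>u v. {u, v} \<in> E - {f} \<Longrightarrow> u \<in> W \<longleftrightarrow> v \<in> W"
  shows "f \<in> F"
proof (rule ccontr)
  assume "f \<notin> F"
  then have *: "\<And>u v. {u, v} \<in> F \<Longrightarrow> u \<in> W \<longleftrightarrow> v \<in> W"
    using F E unfolding spanning_forest_def by blast
  have "acyclic_graph (insert f F)"
    using bridge_not_in_cycle[OF _ f(2-4) *] F
    unfolding acyclic_graph_def spanning_forest_def by blast
  then have "insert f F = F" using F f unfolding spanning_forest_def by blast
  then show False using \<open>f \<notin> F\<close> by blast
qed

lemma revealed_mono: "s \<le> t \<Longrightarrow> revealed A n E sid s \<subseteq> revealed A n E sid t"
proof -
  assume "s \<le> t"
  then have "{1..s} \<subseteq> {1..t}" by simp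
  then show ?thesis unfolding revealed_def by blast
qed

lemma forest_found_mono:
  "forest_found A n E sid s \<Longrightarrow> s \<le> t \<Longrightarrow> forest_found A n E sid t"
  unfolding forest_found_def using revealed_mono by blast

section \<open>The hard graphs\<close>

text \<open>The vertices above \<open>k\<close> hang as leaves on vertex 1, so that the graph can be
  connected on all \<open>n\<close> vertices at the cost of only a linear number of extra
  edges.\<close>

definition two_cliques :: "nat \<Rightarrow> nat \<Rightarrow> nat set \<Rightarrow> edge \<Rightarrow> edge set" where
  "two_cliques n k S f = {e. e \<subseteq> S \<and> card e = 2} \<union> {e. e \<subseteq> {1..k} - S \<and> card e = 2} \<union>
     {f} \<union> (\<lambda>j. {1, j}) ` {k<..n}"

context
  fixes n k :: nat and S :: "nat set" and a b :: nat
  assumes k: "2 \<le> k" "k \<le> n" and S: "S \<subseteq> {1..k}" and a: "a \<in> S" and b: "b \<in> {1..k}" "b \<notin> S"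
begin

lemma simple_two_cliques: "simple_graph n (two_cliques n k S {a, b})"
proof -
  have "{1, j} \<in> possible_edges n" if "j \<in> {k<..n}" for j
    using that k by (auto simp: possible_edges_def)
  moreover have "{a, b} \<in> possible_edges n"
    using k S a b by (auto simp: possible_edges_def card_2_iff)
  moreover have "e \<in> possible_edges n" if "e \<subseteq> {1..k}" "card e = 2" for e
    using that k by (auto simp: possible_edges_def)
  ultimately show ?thesis
    using S unfolding simple_graph_def two_cliques_def by blast
qed

lemma connected_two_cliques: "connected_graph n (two_cliques n k S {a, b})"
proof -
  let ?E = "two_cliques n k S {a, b}"
  let ?R = "{(x, y). {x, y} \<in> ?E}"
  have sy: "sym (?R\<^sup>*)" by (rule sym_rtrancl) (auto simp: sym_def insert_commute)
  have cl: "(u, v) \<in> ?R\<^sup>*" if "u \<in> S \<and> v \<in> S \<or> u \<in> {1..k} - S \<and> v \<in> {1..k} - S" for u v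
  proof (cases "u = v")
    case False
    then have "(u, v) \<in> ?R" using that by (auto simp: two_cliques_def)
    then show ?thesis by blast
  qed simp
  have ba: "(b, a) \<in> ?R\<^sup>*" by (rule r_into_rtrancl) (simp add: two_cliques_def insert_commute)
  have V: "(u, a) \<in> ?R\<^sup>*" if "u \<in> {1..k}" for u
    using cl[of u a] cl[of u b] ba a b that by (cases "u \<in> S") (auto intro: rtrancl_trans)
  have all: "(u, a) \<in> ?R\<^sup>*" if "u \<in> {1..n}" for u
  proof (cases "u \<le> k")
    case True
    then show ?thesis using V that by simp
  next
    case False
    then have "(u, 1) \<in> ?R" using that by (auto simp: two_cliques_def insert_commute)
    moreover have "(1, a) \<in> ?R\<^sup>*" using V k by simp
    ultimately show ?thesis by (meson converse_rtrancl_into_rtrancl)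
  qed
  show ?thesis unfolding connected_graph_def
    using all sy by (meson rtrancl_trans symD)
qed

lemma finite_two_cliques: "finite (two_cliques n k S {a, b})"
proof (rule finite_subset)
  show "two_cliques n k S {a, b} \<subseteq> Pow {1..n}"
    using simple_two_cliques unfolding simple_graph_def possible_edges_def by blast
qed simp

lemma card_two_cliques_ge: "(real k)\<^sup>2 / 8 \<le> real (card (two_cliques n k S {a, b}))"
proof -
  let ?X = "{e. e \<subseteq> S \<and> card e = 2}" and ?Y = "{e. e \<subseteq> {1..k} - S \<and> card e = 2}"
  have finS: "finite S" using S finite_subset by blast
  define s r where "s = card S" and "r = card ({1..k} - S)"
  have sr: "s + r = k" unfolding s_def r_def
    using card_Diff_subset[OF finS S] card_mono[OF _ S] by simp
  have disj: "?X \<inter> ?Y = {}"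
  proof (rule ccontr)
    assume "?X \<inter> ?Y \<noteq> {}"
    then obtain e where "e \<subseteq> S" "e \<subseteq> {1..k} - S" "card e = 2" by blast
    moreover from this(1,2) have "e = {}" by blast
    ultimately show False by simp
  qed
  have notf: "{a, b} \<notin> ?X \<union> ?Y" using a b(2) by simp
  have fin: "finite ?X" "finite ?Y" using finS by auto
  have "card ?X + card ?Y + 1 = card (insert {a, b} (?X \<union> ?Y))"
    using disj notf fin by (simp add: card_Un_disjoint)
  also have "\<dots> \<le> card (two_cliques n k S {a, b})"
    by (rule card_mono[OF finite_two_cliques]) (auto simp: two_cliques_def)
  finally have "(s choose 2) + (r choose 2) + 1 \<le> card (two_cliques n k S {a, b})"
    using n_subsets[OF finS] n_subsets[of "{1..k} - S"] by (simp add: s_def r_def)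
  then have "real (s choose 2) + real (r choose 2) + 1 \<le> real (card (two_cliques n k S {a, b}))"
    by linarith
  moreover have ch: "real (x choose 2) = (real x)\<^sup>2 / 2 - real x / 2" for x
    by (cases x) (auto simp: choose_two real_of_nat_div power2_eq_square field_simps)
  moreover have "(real k)\<^sup>2 / 8 \<le> (real s)\<^sup>2 / 2 - real s / 2 + ((real r)\<^sup>2 / 2 - real r / 2) + 1"
  proof -
    \<comment> \<open>Eight times the difference of the two sides of the claim is this sum of
      squares plus 4; the balanced split \<open>s = r\<close> is the worst case.\<close>
    have "0 \<le> (real s + real r - 2)\<^sup>2 + 2 * (real s - real r)\<^sup>2" by simp
    then show ?thesis unfolding sr[symmetric] of_nat_add
      by (simp add: power2_eq_square field_simps)
  qed
  ultimately show ?thesis by (simp add: ch)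
qed

lemma card_two_cliques_le: "card (two_cliques n k S {a, b}) \<le> k\<^sup>2 div 2 + n"
proof -
  let ?P = "{e. e \<subseteq> {1..k} \<and> card e = 2}"
  have "two_cliques n k S {a, b} \<subseteq> ?P \<union> (\<lambda>j. {1, j}) ` {k<..n}"
    using S a b by (auto simp: two_cliques_def card_2_iff)
  then have "card (two_cliques n k S {a, b}) \<le> card (?P \<union> (\<lambda>j. {1, j}) ` {k<..n})"
    by (intro card_mono) auto
  also have "\<dots> \<le> card ?P + card {k<..n}"
    by (meson add_le_mono card_Un_le card_image_le finite_greaterThanAtMost le_refl le_trans)
  also have "\<dots> \<le> k\<^sup>2 div 2 + n"
  proof -
    have "card ?P = k * (k - 1) div 2" using n_subsets[of "{1..k}" 2] by (simp add: choose_two)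
    also have "\<dots> \<le> k\<^sup>2 div 2" by (intro div_le_mono) (simp add: power2_eq_square)
    finally show ?thesis by simp
  qed
  finally show ?thesis .
qed

lemma bridge_two_cliques:
  assumes "spanning_forest (two_cliques n k S {a, b}) F"
  shows "{a, b} \<in> F"
proof (rule bridge_in_spanning_forest[OF assms])
  \<comment> \<open>The leaves must be on the same side as vertex 1, so that no pendant edge
    crosses.\<close>
  let ?W = "S \<union> (if 1 \<in> S then {k<..n} else {})"
  show "a \<in> ?W" "b \<notin> ?W" using a b by auto
  show "u \<in> ?W \<longleftrightarrow> v \<in> ?W" if "{u, v} \<in> two_cliques n k S {a, b} - {{a, b}}" for u v
  proof -
    have "{u, v} \<subseteq> S \<or> {u, v} \<subseteq> {1..k} - S \<or> (\<exists>j\<in>{k<..n}. {u, v} = {1, j})"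
      using that by (simp add: two_cliques_def image_iff) blast
    then show ?thesis
    proof (elim disjE bexE)
      fix j assume "j \<in> {k<..n}" "{u, v} = {1, j}"
      moreover from this(1) have "j \<notin> S" using S by auto
      ultimately show ?thesis using k by (auto simp: doubleton_eq_iff)
    next
      assume "{u, v} \<subseteq> {1..k} - S"
      then show ?thesis by simp
    qed simp
  qed
qed (simp_all add: two_cliques_def)

end

section \<open>The lower bound\<close>

text \<open>IDs are assigned to all possible edges before the graph is chosen. Each query then
  becomes a fixed edge set, and the cut can be selected against these sets.\<close>

lemma ex_hard_graph:
  assumes ids: "enough_ids ids" and A: "finds_spanning_forests ids A" and k: "2 \<le> k" "k \<le> n"
  shows "\<exists>E sid. simple_graph n E \<and> connected_graph n E \<and> id_assignment (ids n) E sid \<and>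
    (real k)\<^sup>2 / 8 \<le> real (card E) \<and> card E \<le> k\<^sup>2 div 2 + n \<and>
    (real k)\<^sup>2 / 8 \<le> real (running_time A n E sid)"
proof -
  have finP: "finite (possible_edges n)"
    by (rule finite_subset[of _ "Pow {1..n}"]) (auto simp: possible_edges_def)
  have cP: "card (possible_edges n) = n choose 2"
    using n_subsets[of "{1..n}" 2] by (simp add: possible_edges_def)
  obtain sid where sid: "inj_on sid (possible_edges n)" "sid ` possible_edges n \<subseteq> ids n"
  proof -
    have "\<exists>J\<subseteq>ids n. finite J \<and> card J = n choose 2"
    proof (cases "finite (ids n)")
      case True
      then have "n choose 2 \<le> card (ids n)" using ids by (auto simp: enough_ids_def)
      then show ?thesis by (metis obtain_subset_with_card_n)
    next
      case False
      then show ?thesis using infinite_arbitrarily_large by blast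
    qed
    then obtain J where "J \<subseteq> ids n" "finite J" "card (possible_edges n) \<le> card J"
      using cP by auto
    then show thesis using card_le_inj[OF finP] that by (metis subset_trans)
  qed
  \<comment> \<open>The largest \<open>t\<close> with \<open>2 * t < k choose 2\<close>; exceeding
    it forces the running time to be at least half of \<open>k choose 2\<close>.\<close>
  define t where "t = ((k choose 2) - 1) div 2"
  have k2: "k choose 2 > 0" using k by simp
  have "2 * t < k choose 2" using k2 unfolding t_def by linarith
  then have t: "2 * t < card {1..k} choose 2" by simp
  \<comment> \<open>The edges that would broadcast at step \<open>i\<close> if present; this does
    not depend on \<open>E\<close>.\<close>
  define T where "T i = {e \<in> possible_edges n. Station (sid e) \<in> A n i \<or> Edge e \<in> A n i}" for i
  obtain S f where S: "S \<subseteq> {1..k}" and f: "f \<subseteq> {1..k}" "card f = 2" "card (f \<inter> S) = 1"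
    and hit: "\<And>i. i \<in> {1..t} \<Longrightarrow> f \<in> T i \<Longrightarrow> \<exists>e\<in>T i. e \<subseteq> {1..k} \<and> card e = 2 \<and> card (e \<inter> S) \<noteq> 1"
    using ex_cut_edge_not_isolated[OF _ t, of T] by auto
  obtain a where fa: "f \<inter> S = {a}" using f(3) by (auto simp: card_1_singleton_iff)
  obtain b where fb: "f = {a, b}" "a \<noteq> b"
  proof -
    have "a \<in> f" using fa by auto
    moreover have "finite f" using f(1) finite_subset by blast
    ultimately have "card (f - {a}) = 1" using f(2) by simp
    then obtain b where "f - {a} = {b}" by (auto simp: card_1_singleton_iff)
    then show thesis using that \<open>a \<in> f\<close> by blast
  qed
  have ab: "a \<in> S" "b \<in> {1..k}" "b \<notin> S" using fa fb f(1) by auto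
  note G = k S ab
  define E where "E = two_cliques n k S {a, b}"
  have sim: "simple_graph n E" unfolding E_def by (rule simple_two_cliques[OF G])
  then have EP: "E \<subseteq> possible_edges n" by (simp add: simple_graph_def)
  then have ida: "id_assignment (ids n) E sid"
    using sid unfolding id_assignment_def by (meson image_mono inj_on_subset subset_trans)
  \<comment> \<open>Whenever \<open>f\<close> broadcasts, so does some uncut edge of the same query
    within \<open>{1..k}\<close>: being uncut, it belongs to one of the two cliques. Hence
    \<open>f\<close> is never heard alone.\<close>
  have "f \<notin> revealed A n E sid t"
  proof
    assume "f \<in> revealed A n E sid t"
    then obtain i where i: "i \<in> {1..t}" "broadcasting E sid (A n i) = {f}"
      by (auto simp: revealed_def)
    then have "f \<in> T i" using EP by (auto simp: broadcasting_def T_def)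
    then obtain e where e: "e \<in> T i" "e \<subseteq> {1..k}" "card e = 2" "card (e \<inter> S) \<noteq> 1"
      using hit i by blast
    then obtain x y where xy: "e = {x, y}" "x \<noteq> y" by (auto simp: card_2_iff)
    have "e \<subseteq> S \<or> e \<subseteq> {1..k} - S" using e xy by (auto simp: Int_insert_left split: if_splits)
    then have "e \<in> E" using e by (auto simp: E_def two_cliques_def)
    then have "e \<in> broadcasting E sid (A n i)" using e by (auto simp: broadcasting_def T_def)
    then have "e = f" using i by simp
    then show False using e f by simp
  qed
  then have nf: "\<not> forest_found A n E sid t"
    using bridge_two_cliques[OF G] fb unfolding forest_found_def E_def by blast
  have "\<exists>s. forest_found A n E sid s"
    using A sim ida unfolding finds_spanning_forests_def by blast
  then have "forest_found A n E sid (running_time A n E sid)"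
    unfolding running_time_def by (rule LeastI_ex)
  then have "t < running_time A n E sid"
    using nf forest_found_mono by (meson not_le)
  then have "k choose 2 \<le> 2 * running_time A n E sid" using k2 unfolding t_def by linarith
  then have "real (k choose 2) \<le> 2 * real (running_time A n E sid)" by linarith
  moreover have "(real k)\<^sup>2 / 4 \<le> real (k choose 2)"
  proof -
    have "real (k choose 2) = real k * (real k - 1) / 2"
      using k by (auto simp: choose_two real_of_nat_div of_nat_diff)
    moreover have "0 \<le> real k * (real k - 2)" using k by simp
    ultimately show ?thesis by (simp add: power2_eq_square algebra_simps)
  qed
  ultimately have "(real k)\<^sup>2 / 8 \<le> real (running_time A n E sid)" by linarith
  then show ?thesis
    using sim ida connected_two_cliques[OF G] card_two_cliques_ge[OF G] card_two_cliques_le[OF G]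
    unfolding E_def by blast
qed

text \<open>The choice is the integer part of the square root of \<open>4 * m\<close>, or
  \<open>n\<close> if that is smaller. In the capped case the bound
  \<open>real m \<le> C * (real n)\<^sup>2\<close> keeps the square of order
  \<open>m\<close>.\<close>

lemma ex_clique_size:
  fixes C :: real
  assumes "C > 0" "2 \<le> n" "1 \<le> m" "real m \<le> C * (real n)\<^sup>2"
  shows "\<exists>k. 2 \<le> k \<and> k \<le> n \<and> k\<^sup>2 \<le> 4 * m \<and> min (1/4) (1/C) * real m \<le> (real k)\<^sup>2"
proof (cases "n\<^sup>2 \<le> 4 * m")
  case True
  have "min (1/4) (1/C) * real m \<le> 1/C * real m" by (intro mult_right_mono) auto
  also have "\<dots> \<le> (real n)\<^sup>2" using assms by (simp add: field_simps)
  finally show ?thesis using True assms by blast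
next
  case False
  define k where "k = (GREATEST k. k\<^sup>2 \<le> 4 * m)"
  have bd: "y \<le> 4 * m" if "y\<^sup>2 \<le> 4 * m" for y :: nat
    using that by (meson le_trans power2_nat_le_imp_le le_refl self_le_ge2_pow)
  have k: "k\<^sup>2 \<le> 4 * m" unfolding k_def by (rule GreatestI_nat[of _ 0]) (use bd in auto)
  have gr: "y \<le> k" if "y\<^sup>2 \<le> 4 * m" for y
    unfolding k_def by (rule Greatest_le_nat) (use that bd in auto)
  \<comment> \<open>The factor 4 matters here: already \<open>m = 1\<close> admits
    \<open>k = 2\<close>.\<close>
  have "2 \<le> k" using assms by (intro gr) auto
  have "k \<le> n"
    using k False by (meson le_trans linear power_mono zero_le)
  have "real m \<le> (real k)\<^sup>2"
  proof -
    \<comment> \<open>Maximality of \<open>k\<close> together with \<open>Suc k \<le> 2 * k\<close>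
      gives \<open>4 * m < 4 * k\<^sup>2\<close>.\<close>
    have "\<not> (Suc k)\<^sup>2 \<le> 4 * m" using gr by fastforce
    then have "4 * m < (Suc k)\<^sup>2" by simp
    also have "\<dots> \<le> (2 * k)\<^sup>2" using \<open>2 \<le> k\<close> by (intro power_mono) auto
    finally have "m < k\<^sup>2" by (simp add: power_mult_distrib)
    then show ?thesis by (metis less_imp_le of_nat_le_iff of_nat_power)
  qed
  then have "min (1/4) (1/C) * real m \<le> (real k)\<^sup>2"
  proof (rule order_trans[rotated])
    have "min (1/4) (1/C) * real m \<le> 1 * real m"
      by (intro mult_right_mono) (simp_all add: min.coboundedI1)
    then show "min (1/4) (1/C) * real m \<le> real m" by simp
  qed
  then show ?thesis using k \<open>2 \<le> k\<close> \<open>k \<le> n\<close> by blast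
qed

text \<open>A connected graph has at least \<open>n - 1\<close> edges, so having \<Theta>(m) edges
  forces \<open>m\<close> to be at least of order \<open>n\<close>; the constant \<open>c\<close>
  expresses this.\<close>

theorem theorem3:
  fixes c C :: real
  assumes "c > 0" and "C > 0"
  shows "\<exists>c\<^sub>1 c\<^sub>2 c\<^sub>3 :: real. c\<^sub>1 > 0 \<and> c\<^sub>2 > 0 \<and> c\<^sub>3 > 0 \<and>
    (\<forall>ids A. enough_ids ids \<and> oblivious_algorithm ids A \<and> finds_spanning_forests ids A \<longrightarrow>
      (\<forall>n m :: nat. n \<ge> 2 \<and> c * real n \<le> real m \<and> real m \<le> C * (real n)\<^sup>2 \<longrightarrow>
        (\<exists>E sid. simple_graph n E \<and> connected_graph n E \<and> id_assignment (ids n) E sid \<and>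
           c\<^sub>1 * real m \<le> real (card E) \<and> real (card E) \<le> c\<^sub>2 * real m \<and>
           c\<^sub>3 * real m \<le> real (running_time A n E sid))))"
proof -
  \<comment> \<open>The minimum comes from the choice of the clique size, the factor 1/8 from the
    bounds of order \<open>k\<^sup>2 / 8\<close> on edge count and running time.\<close>
  define d where "d = min (1/4) (1/C) / 8"
  have d: "d > 0" using assms by (simp add: d_def)
  have "\<exists>E sid. simple_graph n E \<and> connected_graph n E \<and> id_assignment (ids n) E sid \<and>
      d * real m \<le> real (card E) \<and> real (card E) \<le> (2 + 1/c) * real m \<and>
      d * real m \<le> real (running_time A n E sid)"
    if ids: "enough_ids ids" and A: "finds_spanning_forests ids A"
      and n: "2 \<le> n" "c * real n \<le> real m" "real m \<le> C * (real n)\<^sup>2" for ids A n m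
  proof -
    have "0 < c * real n" using assms n by simp
    then have "1 \<le> m" using n(2) by linarith
    then obtain k where k: "2 \<le> k" "k \<le> n" "k\<^sup>2 \<le> 4 * m" "min (1/4) (1/C) * real m \<le> (real k)\<^sup>2"
      using ex_clique_size[OF assms(2) n(1) _ n(3)] by blast
    have low: "d * real m \<le> (real k)\<^sup>2 / 8" using k(4) by (simp add: d_def)
    have "real n \<le> 1/c * real m" using n(2) assms by (simp add: field_simps)
    \<comment> \<open>The pairs within \<open>{1..k}\<close> contribute at most \<open>2 * m\<close>
      edges, and the pendant edges at most \<open>n\<close>, which is at most \<open>m\<close>
      divided by \<open>c\<close>.\<close>
    then have up: "real x \<le> (2 + 1/c) * real m" if "x \<le> k\<^sup>2 div 2 + n" for x
    proof -
      have "x \<le> 2 * m + n" using that k(3) by linarith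
      then have "real x \<le> 2 * real m + real n" by linarith
      then show ?thesis using \<open>real n \<le> 1/c * real m\<close> by (simp add: distrib_right)
    qed
    show ?thesis using ex_hard_graph[OF ids A k(1,2)] low up by (meson order_trans)
  qed
  moreover have "2 + 1/c > 0" using assms by (simp add: add_pos_pos)
  ultimately show ?thesis using d by blast
qed

end
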